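(* Let $T$ be an $\alpha$-averaged operator on a real Hilbert space $H$ with $\operatorname{Fix}T\ne\emptyset$ and $\alpha\in(0,1)$. Suppose $T$ is bounded Hölder regular. Let $x^0\in H$ and set $x^{t+1}=T(x^t)$ for $t\in\mathbb{N}$. Then $x^t\to\bar x$ in norm for some $\bar x\in\operatorname{Fix}T$ at least with a sublinear rate $O(t^{-\rho})$ for some $\rho>0$. In particular, if $T$ is bounded Hölder regular with uniform exponent $\gamma\in(0,1]$, then there exist $M>0$ and $r\in[0,1)$ such that, for all $t\ge1$, $$\|x^t-\bar x\|\le\begin{cases}M\,t^{-\frac{\gamma}{2(1-\gamma)}},&\gamma\in(0,1),\\ M\,r^t,&\gamma=1.\end{cases}$$
   Context: $\mathbb{N}=\{0,1,2,\dots\}$; $\operatorname{Fix}T=\{x\in H: T(x)=x\}$; $d(x,A)=\inf_{a\in A}\|x-a\|$. An operator $T:H\to H$ is $\alpha$-averaged, $\alpha\in(0,1)$, if $T=(1-\alpha)I+\alpha R$ for some nonexpansive $R:H\to H$. An operator $T:H\to H$ is bounded Hölder regular if for each bounded set $K\subseteq H$ there exist $\gamma\in(0,1]$ and $\mu>0$ such that $d(x,\operatorname{Fix}T)\le\mu\|x-T(x)\|^\gamma$ for all $x\in K$. If the exponent $\gamma$ can be chosen independently of $K$, $T$ is bounded Hölder regular with uniform exponent $\gamma$. Convergence with rate $O(t^{-\rho})$ means $\|x^t-\bar x\|\le Mt^{-\rho}$ for all $t\ge1$ and some constant $M$. *)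

theory Defs
  imports "HOL-Analysis.Analysis"
begin

definition Fix :: "('a \<Rightarrow> 'a) \<Rightarrow> 'a set" where
  "Fix T = {x. T x = x}"

definition nonexpansive :: "('a::metric_space \<Rightarrow> 'a) \<Rightarrow> bool" where
  "nonexpansive R \<longleftrightarrow> 1-lipschitz_on UNIV R"

definition averaged :: "real \<Rightarrow> ('a::real_normed_vector \<Rightarrow> 'a) \<Rightarrow> bool" where
  "averaged \<alpha> T \<longleftrightarrow> 0 < \<alpha> \<and> \<alpha> < 1 \<and>
     (\<exists>R. nonexpansive R \<and> (\<forall>x. T x = (1 - \<alpha>) *\<^sub>R x + \<alpha> *\<^sub>R R x))"

(* infdist is the usual distance to a set when the set is nonempty (its value for the
   empty set is 0); the theorem assumes that Fix T is nonempty.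
   For \<gamma> > 0 we have 0 powr \<gamma> = 0, so powr is the intended power also at
   fixed points. *)

definition bounded_Hoelder_regular :: "('a::real_normed_vector \<Rightarrow> 'a) \<Rightarrow> bool" where
  "bounded_Hoelder_regular T \<longleftrightarrow>
     (\<forall>K. bounded K \<longrightarrow>
        (\<exists>\<gamma>\<in>{0<..1}. \<exists>\<mu>>0. \<forall>x\<in>K. infdist x (Fix T) \<le> \<mu> * norm (x - T x) powr \<gamma>))"

definition bounded_Hoelder_regular_uniform ::
  "('a::real_normed_vector \<Rightarrow> 'a) \<Rightarrow> real \<Rightarrow> bool" where
  "bounded_Hoelder_regular_uniform T \<gamma> \<longleftrightarrow> \<gamma> \<in> {0<..1} \<and>
     (\<forall>K. bounded K \<longrightarrow>
        (\<exists>\<mu>>0. \<forall>x\<in>K. infdist x (Fix T) \<le> \<mu> * norm (x - T x) powr \<gamma>))"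

definition sublinear_rate :: "(nat \<Rightarrow> 'a::real_normed_vector) \<Rightarrow> 'a \<Rightarrow> real \<Rightarrow> bool" where
  "sublinear_rate x l \<rho> \<longleftrightarrow>
     (\<exists>M. \<forall>t\<ge>1. norm (x t - l) \<le> M * real t powr (- \<rho>))"

end

theory Submission
  imports Defs
begin

text \<open>
  For $y \in \mathrm{Fix}\,T$ an averaged operator satisfies
  $\|Tx-y\|^2 \le \|x-y\|^2 - \frac{1-\alpha}{\alpha}\|x-Tx\|^2$, so the orbit is Fejer monotone
  and $\|x^t-\bar x\| \le 2d_t$ with $d_t = d(x^t,\mathrm{Fix}\,T)$. Taking the infimum over $y$ and
  inserting Hoelder regularity on the (bounded) orbit gives
  $d_{t+1}^2 \le d_t^2 - k\,(d_t^2)^{1/\gamma}$. For $\gamma=1$ this is a geometric decay; for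
  $\gamma<1$ the quantity $(d_t^2)^{-(1-\gamma)/\gamma}$ grows at least linearly in $t$.
\<close>

section \<open>Scalar recurrences with power decrease\<close>

text \<open>Discrete counterpart of the equation a' = -k a^(1+\<theta>), along whose positive
  solutions a^(-\<theta>) has constant derivative \<theta> k. Here each step raises
  \<open>a t powr (-\<theta>)\<close> by at least \<open>\<theta> * k\<close>, and inverting this
  linear growth gives the bound.\<close>

lemma powr_recurrence_bound:
  fixes a :: "nat \<Rightarrow> real"
  assumes nonneg: "\<And>t. 0 \<le> a t" and "0 < k" "0 < \<theta>"
    and step: "\<And>t. a (Suc t) \<le> a t - k * a t powr (1 + \<theta>)"
    and "1 \<le> t"
  shows "a t \<le> (\<theta> * k * real t) powr (- (1 / \<theta>))"
proof -
  \<comment> \<open>Positivity is essential, because \<open>0 powr (-\<theta>)\<close> is 0. It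
    passes back from \<open>Suc t\<close> to \<open>t\<close>, since the sequence decreases.\<close>
  have lin: "\<theta> * k * real t \<le> a t powr (-\<theta>)" if "0 < a t" for t
    using that
  proof (induction t)
    case 0
    then show ?case by simp
  next
    case (Suc t)
    let ?u = "a (Suc t) / a t"
    have "0 \<le> k * a t powr (1 + \<theta>)" using \<open>0 < k\<close> by simp
    then have le: "a (Suc t) \<le> a t" using step[of t] by linarith
    then have at: "0 < a t" using Suc.prems by linarith
    have u: "0 < ?u" using at Suc.prems by simp
    have "k * (a t powr \<theta> * a t) \<le> a t - a (Suc t)"
      using step[of t] at by (simp add: powr_add mult.commute)
    then have gap: "k * a t powr \<theta> \<le> 1 - ?u"
      using at by (simp add: field_simps)
    \<comment> \<open>Bernoulli's inequality for the exponent -\<theta>, obtained from ln u \<le> u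
      - 1 followed by 1 + s \<le> exp s.\<close>
    have "1 + \<theta> * (1 - ?u) \<le> 1 + (-\<theta>) * ln ?u"
      using ln_le_minus_one[OF u] \<open>0 < \<theta>\<close> mult_left_mono[of "ln ?u" "?u - 1" \<theta>]
      by (simp add: algebra_simps)
    also have "\<dots> \<le> ?u powr (-\<theta>)"
      using at Suc.prems exp_ge_add_one_self[of "-\<theta> * ln ?u"] by (simp add: powr_def)
    finally have "1 + \<theta> * (k * a t powr \<theta>) \<le> ?u powr (-\<theta>)"
      using mult_left_mono[OF gap, of \<theta>] \<open>0 < \<theta>\<close> by linarith
    then have "(1 + \<theta> * (k * a t powr \<theta>)) * a t powr (-\<theta>) \<le> ?u powr (-\<theta>) * a t powr (-\<theta>)"
      by (rule mult_right_mono) simp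
    moreover have "?u powr (-\<theta>) * a t powr (-\<theta>) = a (Suc t) powr (-\<theta>)"
      using at u by (simp flip: powr_mult)
    moreover have "a t powr \<theta> * a t powr (-\<theta>) = 1"
      using at by (simp flip: powr_add)
    ultimately have "a t powr (-\<theta>) + \<theta> * k \<le> a (Suc t) powr (-\<theta>)"
      by (simp add: algebra_simps)
    then show ?case using Suc.IH[OF at] by (simp add: algebra_simps)
  qed
  show ?thesis
  proof (cases "a t = 0")
    case False
    then have pos: "0 < a t" using nonneg[of t] by simp
    \<comment> \<open>The negative exponent reverses \<open>lin\<close>; the smaller base is
      positive because \<open>1 \<le> t\<close>.\<close>
    have "(a t powr (-\<theta>)) powr (- (1 / \<theta>)) \<le> (\<theta> * k * real t) powr (- (1 / \<theta>))"
      using assms by (intro powr_mono2' lin[OF pos]) auto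
    then show ?thesis using pos \<open>0 < \<theta>\<close> by (simp add: powr_powr)
  qed simp
qed

section \<open>Averaged operators\<close>

text \<open>The last term measures the uniform convexity of the squared norm; it is the source of
  the decrease achieved by an averaged operator.\<close>

lemma norm_convex_combination_sq:
  fixes u v :: "'a::real_inner"
  shows "(norm ((1 - \<alpha>) *\<^sub>R u + \<alpha> *\<^sub>R v))\<^sup>2 =
    (1 - \<alpha>) * (norm u)\<^sup>2 + \<alpha> * (norm v)\<^sup>2 - \<alpha> * (1 - \<alpha>) * (norm (u - v))\<^sup>2"
  unfolding power2_norm_eq_inner
  by (simp add: inner_commute[of v u] algebra_simps)

text \<open>Since \<alpha> is nonzero, \<open>y\<close> is also fixed by \<open>R\<close>. The
  identity for convex combinations, applied to \<open>x - y\<close> and \<open>R x - y\<close>, then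
  combines with nonexpansiveness of \<open>R\<close>. The factor (1 - \<alpha>)/\<alpha> appears on
  replacing \<open>x - R x\<close> by \<open>x - T x\<close>, which is \<alpha> times as
  long.\<close>

lemma averaged_Fix_decrease:
  fixes T :: "'a::real_inner \<Rightarrow> 'a"
  assumes "averaged \<alpha> T" "y \<in> Fix T"
  shows "(norm (T x - y))\<^sup>2 \<le> (norm (x - y))\<^sup>2 - (1 - \<alpha>) / \<alpha> * (norm (x - T x))\<^sup>2"
proof -
  from assms(1) obtain R where \<alpha>: "0 < \<alpha>" "\<alpha> < 1" and R: "nonexpansive R"
    and T: "\<And>x. T x = (1 - \<alpha>) *\<^sub>R x + \<alpha> *\<^sub>R R x"
    unfolding averaged_def by blast
  have "\<alpha> *\<^sub>R R y = \<alpha> *\<^sub>R y"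
    using assms(2) T[of y] by (simp add: Fix_def algebra_simps)
  then have Ry: "R y = y" using \<alpha> by simp
  have Rle: "(norm (R x - y))\<^sup>2 \<le> (norm (x - y))\<^sup>2"
    using R lipschitz_onD[of 1 UNIV R x y] Ry
    by (intro power_mono) (auto simp: nonexpansive_def dist_norm)
  have "T x - y = (1 - \<alpha>) *\<^sub>R (x - y) + \<alpha> *\<^sub>R (R x - y)"
    by (simp add: T algebra_simps)
  then have "(norm (T x - y))\<^sup>2 = (1 - \<alpha>) * (norm (x - y))\<^sup>2 + \<alpha> * (norm (R x - y))\<^sup>2
      - \<alpha> * (1 - \<alpha>) * (norm (x - R x))\<^sup>2"
    using norm_convex_combination_sq[of \<alpha> "x - y" "R x - y"] by simp
  moreover have "x - T x = \<alpha> *\<^sub>R (x - R x)"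
    by (simp add: T algebra_simps)
  then have "(1 - \<alpha>) / \<alpha> * (norm (x - T x))\<^sup>2 = \<alpha> * (1 - \<alpha>) * (norm (x - R x))\<^sup>2"
    using \<alpha> by (simp add: power_mult_distrib power2_eq_square)
  moreover have "(1 - \<alpha>) * (norm (x - y))\<^sup>2 + \<alpha> * (norm (x - y))\<^sup>2 = (norm (x - y))\<^sup>2"
    by (simp add: algebra_simps)
  ultimately show ?thesis
    using mult_left_mono[OF Rle, of \<alpha>] \<alpha> by linarith
qed

lemma averaged_continuous:
  assumes "averaged \<alpha> T"
  shows "continuous_on UNIV T"
proof -
  from assms obtain R where R: "nonexpansive R"
    and T: "T = (\<lambda>x. (1 - \<alpha>) *\<^sub>R x + \<alpha> *\<^sub>R R x)"
    unfolding averaged_def by blast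
  have "continuous_on UNIV R"
    using R lipschitz_on_continuous_on unfolding nonexpansive_def by blast
  then show ?thesis unfolding T by (intro continuous_intros)
qed

lemma closed_Fix:
  fixes T :: "'a::real_normed_vector \<Rightarrow> 'a"
  assumes "continuous_on UNIV T"
  shows "closed (Fix T)"
  unfolding Fix_def by (intro closed_Collect_eq assms continuous_on_id)

section \<open>Fejer monotone sequences\<close>

text \<open>Through any \<open>y\<close> in \<open>F\<close> the triangle inequality costs at most
  twice the distance from \<open>x t\<close> to \<open>y\<close>, as \<open>x s\<close> is no
  farther from \<open>y\<close>; then the infimum over \<open>y\<close> is taken.\<close>

lemma Fejer_infdist_bound:
  fixes x :: "nat \<Rightarrow> 'a::real_normed_vector"
  assumes "F \<noteq> {}" and fejer: "\<And>y t. y \<in> F \<Longrightarrow> norm (x (Suc t) - y) \<le> norm (x t - y)"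
    and "t \<le> s"
  shows "norm (x s - x t) \<le> 2 * infdist (x t) F"
proof -
  have mono: "norm (x s - y) \<le> norm (x t - y)" if "y \<in> F" for y
    using \<open>t \<le> s\<close> fejer[OF that] lift_Suc_antimono_le[of "\<lambda>n. norm (x n - y)"] by blast
  have "norm (x s - x t) / 2 \<le> dist (x t) y" if "y \<in> F" for y
    using mono[OF that] norm_triangle_ineq4[of "x s - y" "x t - y"]
    by (simp add: dist_norm)
  then have "norm (x s - x t) / 2 \<le> infdist (x t) F"
    unfolding infdist_notempty[OF \<open>F \<noteq> {}\<close>] by (rule cINF_greatest[OF \<open>F \<noteq> {}\<close>])
  then show ?thesis by simp
qed

text \<open>The tail after index t stays in a ball of radius \<open>2 * infdist (x t) F\<close>
  about \<open>x t\<close>. Vanishing radii make the sequence Cauchy, continuity of the distance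
  puts the limit in the closed set \<open>F\<close>, and letting s tend to infinity keeps the radius
  as an error bound.\<close>

lemma Fejer_convergent:
  fixes x :: "nat \<Rightarrow> 'a::{real_normed_vector,complete_space}"
  assumes "F \<noteq> {}" "closed F"
    and fejer: "\<And>y t. y \<in> F \<Longrightarrow> norm (x (Suc t) - y) \<le> norm (x t - y)"
    and lim: "(\<lambda>t. infdist (x t) F) \<longlonglongrightarrow> 0"
  obtains l where "l \<in> F" "x \<longlonglongrightarrow> l" "\<And>t. norm (x t - l) \<le> 2 * infdist (x t) F"
proof -
  have bound: "norm (x s - x t) \<le> 2 * infdist (x t) F" if "t \<le> s" for s t
    using \<open>F \<noteq> {}\<close> fejer that by (rule Fejer_infdist_bound)
  have "Cauchy x"
  proof (rule metric_CauchyI)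
    fix e :: real
    assume "0 < e"
    \<comment> \<open>The quarter is doubled by \<open>bound\<close>, then doubled again when two
      tail points are compared through \<open>x N\<close>.\<close>
    then obtain N where N: "infdist (x N) F < e / 4"
      using order_tendstoD(2)[OF lim, of "e / 4"] by (auto simp: eventually_sequentially)
    have near: "norm (x m - x N) < e / 2" if "N \<le> m" for m
      using bound[OF that] N by simp
    have "dist (x m) (x n) < e" if "N \<le> m" "N \<le> n" for m n
      using dist_triangle_half_l[of "x m" "x N" e "x n"] near that by (simp add: dist_norm)
    then show "\<exists>M. \<forall>m\<ge>M. \<forall>n\<ge>M. dist (x m) (x n) < e" by blast
  qed
  then obtain l where l: "x \<longlonglongrightarrow> l"
    by (meson Cauchy_convergent convergent_def)
  have "(\<lambda>t. infdist (x t) F) \<longlonglongrightarrow> infdist l F"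
    by (intro tendsto_infdist l)
  then have "infdist l F = 0" using lim LIMSEQ_unique by blast
  then have "l \<in> F" using assms(1,2) in_closed_iff_infdist_zero by blast
  moreover have "norm (x t - l) \<le> 2 * infdist (x t) F" for t
  proof (rule tendsto_upperbound)
    show "(\<lambda>s. norm (x t - x s)) \<longlonglongrightarrow> norm (x t - l)"
      by (intro tendsto_intros l)
    show "\<forall>\<^sub>F s in sequentially. norm (x t - x s) \<le> 2 * infdist (x t) F"
      using bound by (intro eventually_sequentiallyI[of t]) (simp add: norm_minus_commute[of "x t"])
  qed simp
  ultimately show ?thesis using l that by blast
qed

section \<open>Decay of the distance to the set\<close>

text \<open>No nearest point is chosen: the square root of \<open>(infdist v F)\<^sup>2 + e\<close>
  is a lower bound for all distances from \<open>u\<close> to points of \<open>F\<close>, hence for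
  their infimum.\<close>

lemma infdist_sq_decrease:
  fixes u v :: "'a::real_normed_vector"
  assumes "F \<noteq> {}" "0 \<le> e"
    and dec: "\<And>y. y \<in> F \<Longrightarrow> (norm (v - y))\<^sup>2 \<le> (norm (u - y))\<^sup>2 - e"
  shows "(infdist v F)\<^sup>2 \<le> (infdist u F)\<^sup>2 - e"
proof -
  have "sqrt ((infdist v F)\<^sup>2 + e) \<le> dist u y" if "y \<in> F" for y
  proof (rule real_le_lsqrt)
    have "(infdist v F)\<^sup>2 \<le> (norm (v - y))\<^sup>2"
      using infdist_le[OF that, of v] by (intro power_mono) (auto simp: dist_norm infdist_nonneg)
    then show "(infdist v F)\<^sup>2 + e \<le> (dist u y)\<^sup>2"
      using dec[OF that] by (simp add: dist_norm)
  qed simp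
  then have "sqrt ((infdist v F)\<^sup>2 + e) \<le> infdist u F"
    using \<open>F \<noteq> {}\<close> by (simp add: infdist_def cINF_greatest)
  then have "(infdist v F)\<^sup>2 + e \<le> (infdist u F)\<^sup>2"
    using sqrt_le_D by blast
  then show ?thesis by simp
qed

lemma infdist_rate:
  fixes x :: "nat \<Rightarrow> 'a::real_normed_vector"
  assumes "F \<noteq> {}" "0 < c" "0 < \<mu>" and \<gamma>: "\<gamma> \<in> {0<..1}"
    and dec: "\<And>y t. y \<in> F \<Longrightarrow>
      (norm (x (Suc t) - y))\<^sup>2 \<le> (norm (x t - y))\<^sup>2 - c * (norm (x t - x (Suc t)))\<^sup>2"
    and reg: "\<And>t. infdist (x t) F \<le> \<mu> * norm (x t - x (Suc t)) powr \<gamma>"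
  shows "\<exists>M>0. \<exists>r\<in>{0..<1}. \<forall>t\<ge>1. infdist (x t) F \<le>
    (if \<gamma> < 1 then M * real t powr (- (\<gamma> / (2 * (1 - \<gamma>)))) else M * r ^ t)"
proof -
  define a where "a t = (infdist (x t) F)\<^sup>2" for t
  \<comment> \<open>Squaring the regularity bound and raising it to the power 1/\<gamma> gives (a t
    / \<mu>^2)^(1/\<gamma>) \<le> \<delta>^2, where \<delta> is the step length; multiplying by
    \<open>c\<close> leaves this coefficient of a t^(1/\<gamma>).\<close>
  define k where "k = c / (\<mu>\<^sup>2) powr (1 / \<gamma>)"
  have "0 < k" using \<open>0 < c\<close> \<open>0 < \<mu>\<close> by (simp add: k_def)
  have step: "a (Suc t) \<le> a t - k * a t powr (1 / \<gamma>)" for t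
  proof -
    let ?\<delta> = "norm (x t - x (Suc t))"
    have "a t / \<mu>\<^sup>2 \<le> (?\<delta> powr \<gamma>)\<^sup>2"
      using power_mono[OF reg[of t], of 2] \<open>0 < \<mu>\<close> infdist_nonneg[of "x t" F]
      by (simp add: a_def power_mult_distrib divide_simps mult.commute)
    also have "\<dots> = (?\<delta>\<^sup>2) powr \<gamma>"
      by (simp add: power2_eq_square powr_mult)
    finally have "(a t / \<mu>\<^sup>2) powr (1 / \<gamma>) \<le> ((?\<delta>\<^sup>2) powr \<gamma>) powr (1 / \<gamma>)"
      using \<gamma> by (intro powr_mono2) (auto simp: a_def)
    also have "\<dots> = ?\<delta>\<^sup>2" using \<gamma> by (simp add: powr_powr)
    finally have "k * a t powr (1 / \<gamma>) \<le> c * ?\<delta>\<^sup>2"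
      using \<open>0 < c\<close> \<open>0 < \<mu>\<close> by (simp add: k_def powr_divide a_def pos_divide_le_eq mult.commute)
    moreover have "a (Suc t) \<le> a t - c * ?\<delta>\<^sup>2"
      unfolding a_def using \<open>F \<noteq> {}\<close> \<open>0 < c\<close> dec by (intro infdist_sq_decrease) auto
    ultimately show ?thesis by linarith
  qed
  have root: "infdist (x t) F = sqrt (a t)" for t
    by (simp add: a_def infdist_nonneg)
  show ?thesis
  proof (cases "\<gamma> < 1")
    case True
    \<comment> \<open>Chosen so that 1/\<gamma> = 1 + \<theta>. The recurrence then gives the
      exponent -1/\<theta> = -\<gamma>/(1 - \<gamma>) for the squared distance, and the square root
      halves it.\<close>
    define \<theta> where "\<theta> = (1 - \<gamma>) / \<gamma>"
    have \<theta>: "0 < \<theta>" "1 / \<gamma> = 1 + \<theta>"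
      using True \<gamma> by (auto simp: \<theta>_def divide_simps)
    define M where "M = (\<theta> * k) powr (- (\<gamma> / (2 * (1 - \<gamma>))))"
    have "infdist (x t) F \<le> M * real t powr (- (\<gamma> / (2 * (1 - \<gamma>))))" if "1 \<le> t" for t
    proof -
      have "a t \<le> (\<theta> * k * real t) powr (- (1 / \<theta>))"
        using step \<theta> \<open>0 < k\<close> that by (intro powr_recurrence_bound) (auto simp: a_def)
      then have "sqrt (a t) \<le> sqrt ((\<theta> * k * real t) powr (- (1 / \<theta>)))" by simp
      also have "\<dots> = (\<theta> * k * real t) powr (- (\<gamma> / (2 * (1 - \<gamma>))))"
        using \<theta> \<open>0 < k\<close> that
        by (simp add: powr_half_sqrt[symmetric] powr_powr \<theta>_def mult.commute)
      also have "\<dots> = M * real t powr (- (\<gamma> / (2 * (1 - \<gamma>))))"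
        using \<theta> \<open>0 < k\<close> by (simp add: M_def powr_mult)
      finally show ?thesis by (simp add: root)
    qed
    moreover have "0 < M" using \<theta> \<open>0 < k\<close> by (simp add: M_def)
    ultimately show ?thesis using True
      by (intro exI[of _ M] conjI bexI[of _ 0]) auto
  next
    case False
    then have "\<gamma> = 1" using \<gamma> by simp
    \<comment> \<open>\<open>k\<close> may exceed 1, while the induction multiplies inequalities by
      a nonnegative ratio.\<close>
    define q where "q = max 0 (1 - k)"
    have q: "0 \<le> q" "q < 1" using \<open>0 < k\<close> by (auto simp: q_def)
    have "a t \<le> q ^ t * a 0" for t
    proof (induction t)
      case (Suc t)
      have "a (Suc t) \<le> (1 - k) * a t"
        using step[of t] \<open>\<gamma> = 1\<close> by (simp add: a_def algebra_simps)
      also have "\<dots> \<le> q * a t" by (intro mult_right_mono) (auto simp: q_def a_def)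
      also have "\<dots> \<le> q * (q ^ t * a 0)" using Suc q by (intro mult_left_mono)
      finally show ?case by simp
    qed simp
    then have "sqrt (a t) \<le> sqrt (q ^ t * a 0)" for t by simp
    then have "infdist (x t) F \<le> sqrt q ^ t * infdist (x 0) F" for t
      by (simp add: root real_sqrt_mult real_sqrt_power)
    \<comment> \<open>Adding 1 keeps the constant positive even if \<open>x 0\<close> has distance 0
      from \<open>F\<close>.\<close>
    moreover have "sqrt q ^ t * infdist (x 0) F \<le> (infdist (x 0) F + 1) * sqrt q ^ t" for t
      using q by (simp add: algebra_simps)
    ultimately have "infdist (x t) F \<le> (infdist (x 0) F + 1) * sqrt q ^ t" for t
      using order_trans by blast
    then show ?thesis using False q infdist_nonneg[of "x 0" F]
      by (intro exI[of _ "infdist (x 0) F + 1"] conjI bexI[of _ "sqrt q"]) auto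
  qed
qed

text \<open>Since n r^n tends to 0, it is bounded. This turns the geometric rate of exponent 1 into
  a sublinear one.\<close>

lemma geometric_le_inverse:
  fixes r :: real
  assumes "0 \<le> r" "r < 1"
  obtains B where "0 < B" "\<And>t. 1 \<le> t \<Longrightarrow> r ^ t \<le> B * real t powr (-1)"
proof -
  have "(\<lambda>n. real n * r ^ n) \<longlonglongrightarrow> 0"
    using powser_times_n_limit_0[of r] assms by simp
  then have "Bseq (\<lambda>n. real n * r ^ n)"
    using convergent_imp_Bseq convergentI by blast
  then obtain B where "0 < B" and B: "\<And>n. norm (real n * r ^ n) \<le> B"
    by (auto simp: Bseq_def)
  have "r ^ t \<le> B * real t powr (-1)" if "1 \<le> t" for t
    using B[of t] assms that by (simp add: powr_minus field_simps)
  then show ?thesis using \<open>0 < B\<close> that by blast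
qed

section \<open>Convergence and rates for the orbit\<close>

theorem corollary3p8:
  fixes T :: "'a::{real_inner,complete_space} \<Rightarrow> 'a"
    and \<alpha> :: real
    and x :: "nat \<Rightarrow> 'a"
    and x0 :: 'a
  assumes "0 < \<alpha>" and "\<alpha> < 1"
    and "averaged \<alpha> T"
    and "Fix T \<noteq> {}"
    and "bounded_Hoelder_regular T"
    and "x 0 = x0"
    and "\<And>t. x (Suc t) = T (x t)"
  shows "\<exists>xbar\<in>Fix T. x \<longlonglongrightarrow> xbar \<and>
           (\<exists>\<rho>>0. sublinear_rate x xbar \<rho>) \<and>
           (\<forall>\<gamma>. bounded_Hoelder_regular_uniform T \<gamma> \<longrightarrow>
              (\<exists>M>0. \<exists>r\<in>{0..<1}. \<forall>t\<ge>1.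
                 norm (x t - xbar) \<le>
                   (if \<gamma> < 1 then M * real t powr (- (\<gamma> / (2 * (1 - \<gamma>))))
                    else M * r ^ t)))"
proof -
  let ?F = "Fix T"
  have "0 < (1 - \<alpha>) / \<alpha>" using assms(1,2) by simp
  have dec: "(norm (x (Suc t) - y))\<^sup>2 \<le>
      (norm (x t - y))\<^sup>2 - (1 - \<alpha>) / \<alpha> * (norm (x t - x (Suc t)))\<^sup>2" if "y \<in> ?F" for y t
    using averaged_Fix_decrease[OF assms(3) that, of "x t"] assms(7) by simp
  have fejer: "norm (x (Suc t) - y) \<le> norm (x t - y)" if "y \<in> ?F" for y t
  proof (rule power2_le_imp_le)
    have "0 \<le> (1 - \<alpha>) / \<alpha> * (norm (x t - x (Suc t)))\<^sup>2"
      using \<open>0 < (1 - \<alpha>) / \<alpha>\<close> by (intro mult_nonneg_nonneg) auto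
    then show "(norm (x (Suc t) - y))\<^sup>2 \<le> (norm (x t - y))\<^sup>2"
      using dec[OF that, of t] by linarith
  qed simp
  \<comment> \<open>The Fejer bound from index 0 encloses the whole orbit, so regularity with K =
    \<open>range x\<close> supplies one exponent and one constant for all iterates.\<close>
  have "bounded (range x)"
    unfolding bounded_def
    using Fejer_infdist_bound[of ?F x 0, OF assms(4)] fejer
    by (intro exI[of _ "x 0"] exI[of _ "2 * infdist (x 0) ?F"])
      (auto simp: dist_norm norm_minus_commute)
  \<comment> \<open>Kept general in \<gamma> and \<mu>: it serves first the exponent belonging to
    this orbit, later every uniform exponent.\<close>
  have rate: "\<exists>M>0. \<exists>r\<in>{0..<1}. \<forall>t\<ge>1. infdist (x t) ?F \<le>
      (if \<gamma> < 1 then M * real t powr (- (\<gamma> / (2 * (1 - \<gamma>)))) else M * r ^ t)"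
    if "\<gamma> \<in> {0<..1}" "0 < \<mu>"
      "\<forall>z\<in>range x. infdist z ?F \<le> \<mu> * norm (z - T z) powr \<gamma>" for \<gamma> \<mu>
    using that assms(7)
    by (intro infdist_rate[of ?F _ _ _ x, OF assms(4) \<open>0 < (1 - \<alpha>) / \<alpha>\<close> that(2,1) dec]) auto
  obtain \<gamma>' \<mu> where \<gamma>': "\<gamma>' \<in> {0<..1}" and "0 < \<mu>"
    and "\<forall>z\<in>range x. infdist z ?F \<le> \<mu> * norm (z - T z) powr \<gamma>'"
    using assms(5) \<open>bounded (range x)\<close> unfolding bounded_Hoelder_regular_def by metis
  from rate[OF this] obtain M r where M: "0 < M" "r \<in> {0..<1}"
    and Mr: "\<And>t. 1 \<le> t \<Longrightarrow> infdist (x t) ?F \<le>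
      (if \<gamma>' < 1 then M * real t powr (- (\<gamma>' / (2 * (1 - \<gamma>')))) else M * r ^ t)"
    by blast
  \<comment> \<open>Both cases of the rate are merged into one power law, with \<rho> = 1 when
    \<gamma>' = 1. This also yields that the distances tend to 0.\<close>
  obtain C \<rho> where "0 < \<rho>"
    and C: "\<And>t. 1 \<le> t \<Longrightarrow> infdist (x t) ?F \<le> C * real t powr (- \<rho>)"
  proof (cases "\<gamma>' < 1")
    case True
    then show ?thesis using that[of "\<gamma>' / (2 * (1 - \<gamma>'))" M] Mr \<gamma>' by simp
  next
    case False
    obtain B where B: "\<And>t. 1 \<le> t \<Longrightarrow> r ^ t \<le> B * real t powr (-1)"
      using geometric_le_inverse M(2) by (metis atLeastLessThan_iff)
    have "infdist (x t) ?F \<le> (M * B) * real t powr (-1)" if "1 \<le> t" for t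
      using Mr[OF that] False mult_left_mono[OF B[OF that], of M] M(1) by (simp add: mult.assoc)
    then show ?thesis using that[of 1 "M * B"] by simp
  qed
  have "(\<lambda>t. real t powr (- \<rho>)) \<longlonglongrightarrow> 0"
    by (rule tendsto_neg_powr[OF _ filterlim_real_sequentially]) (use \<open>0 < \<rho>\<close> in simp)
  then have upper: "(\<lambda>t. C * real t powr (- \<rho>)) \<longlonglongrightarrow> 0"
    by (rule tendsto_mult_right_zero)
  have "(\<lambda>t. infdist (x t) ?F) \<longlonglongrightarrow> 0"
  proof (rule tendsto_sandwich[OF _ _ tendsto_const upper])
    show "\<forall>\<^sub>F t in sequentially. 0 \<le> infdist (x t) ?F"
      by (simp add: infdist_nonneg)
    show "\<forall>\<^sub>F t in sequentially. infdist (x t) ?F \<le> C * real t powr (- \<rho>)"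
      using C by (rule eventually_sequentiallyI)
  qed
  then obtain l where l: "l \<in> ?F" "x \<longlonglongrightarrow> l"
    and bound: "\<And>t. norm (x t - l) \<le> 2 * infdist (x t) ?F"
    using Fejer_convergent[of ?F x] assms(4) closed_Fix[OF averaged_continuous[OF assms(3)]] fejer
    by blast
  have "sublinear_rate x l \<rho>"
    unfolding sublinear_rate_def
    using C by (intro exI[of _ "2 * C"] allI impI order_trans[OF bound]) simp
  \<comment> \<open>The limit \<open>l\<close> is already fixed, so it is common to all uniform
    exponents; passing from distances to errors only doubles the constant.\<close>
  moreover have "\<exists>M>0. \<exists>r\<in>{0..<1}. \<forall>t\<ge>1. norm (x t - l) \<le>
      (if \<gamma> < 1 then M * real t powr (- (\<gamma> / (2 * (1 - \<gamma>)))) else M * r ^ t)"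
    if uni: "bounded_Hoelder_regular_uniform T \<gamma>" for \<gamma>
  proof -
    obtain \<nu> where "\<gamma> \<in> {0<..1}" "0 < \<nu>"
      "\<forall>z\<in>range x. infdist z ?F \<le> \<nu> * norm (z - T z) powr \<gamma>"
      using uni \<open>bounded (range x)\<close> unfolding bounded_Hoelder_regular_uniform_def by metis
    from rate[OF this] obtain N q where N: "0 < N" "q \<in> {0..<1}"
      and Nq: "\<And>t. 1 \<le> t \<Longrightarrow> infdist (x t) ?F \<le>
        (if \<gamma> < 1 then N * real t powr (- (\<gamma> / (2 * (1 - \<gamma>)))) else N * q ^ t)"
      by blast
    have "norm (x t - l) \<le>
        (if \<gamma> < 1 then (2 * N) * real t powr (- (\<gamma> / (2 * (1 - \<gamma>)))) else (2 * N) * q ^ t)"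
      if "1 \<le> t" for t
      using Nq[OF that] bound[of t] by (simp split: if_splits)
    then show ?thesis using N by (intro exI[of _ "2 * N"] conjI bexI[of _ q]) auto
  qed
  ultimately show ?thesis using l \<open>0 < \<rho>\<close> by blast
qed

end
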